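(* Let $R$ be an integral domain. Then, as maps on $\overline{F}(R)$, \[(\text{p.grade})_i=\begin{cases} e, & \text{if } i=0,1,\\ w, & \text{if } i=2.\end{cases}\]
   Context: $R$ has quotient field $K$; $\mathcal{S}(R)$ is the set of all ideals of $R$, $\overline{F}(R)$ the set of nonzero $R$-submodules of $K$, and $(I:_KJ)=\{x\in K\mid xJ\subseteq I\}$. For a commutative ring $S$ and an $S$-module $M$, $Z(M)$ is the set of $s\in S$ with $sm=0$ for some nonzero $m\in M$. A sequence $a_1,\ldots,a_r$ in $S$ is a weak $S$-sequence if $a_i\notin Z(S/(a_1,\ldots,a_{i-1}))$ for $i=1,\ldots,r$. For an ideal $I$ of $S$, $\operatorname{grade}_S(I)\in\{0,1,2,\ldots\}\cup\{\infty\}$ is the supremum of the lengths of weak $S$-sequences contained in $I$. The polynomial grade of an ideal $I$ of $R$ is \[\text{p.grade}(I)=\lim_{m\to\infty}\operatorname{grade}_{R[X_1,\ldots,X_m]}\big(I[X_1,\ldots,X_m]\big).\] For an integer $n\ge0$, the operation $(\text{p.grade})_n$ on $\overline{F}(R)$ is \[I_{(\text{p.grade})_n}=\bigcup_{J\in\mathcal{S}(R),\ \text{p.grade}(J)\ge n}(I:_KJ).\] The $e$-operation is $I_e=K$; the $v$-operation is $I_v=(R:_K(R:_KI))$; the $w$-operation is $I_w=\bigcup\{(I:_KJ)\mid J\text{ a nonzero finitely generated ideal of }R,\ J_v=R\}$, for all $I\in\overline{F}(R)$. *)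

theory Defs
  imports
    "HOL-Decision_Procs.Algebra_Aux"
    "HOL-Computational_Algebra.Polynomial_Factorial"
    "HOL-Library.Poly_Mapping"
    "HOL-Library.Extended_Real"
    "HOL-Algebra.QuotRing"
    "HOL-Algebra.Module"
begin

section \<open>Weak sequences and grade\<close>

definition zero_divisors_on ::
    "('a, 'b) ring_scheme \<Rightarrow> ('a, 'm, 'c) module_scheme \<Rightarrow> 'a set" where
  "zero_divisors_on S M =
     {s \<in> carrier S. \<exists>m \<in> carrier M. m \<noteq> \<zero>\<^bsub>M\<^esub> \<and> s \<odot>\<^bsub>M\<^esub> m = \<zero>\<^bsub>M\<^esub>}"

text \<open>The quotient \<open>S/I\<close> as an \<open>S\<close>-module: \<open>s\<close> acts on a coset as multiplication by the
  coset of \<open>s\<close> in the quotient ring.\<close>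

definition quotient_module :: "('a, 'b) ring_scheme \<Rightarrow> 'a set \<Rightarrow> ('a, 'a set) module" where
  "quotient_module S I =
     \<lparr>carrier = carrier (S Quot I), monoid.mult = monoid.mult (S Quot I), one = one (S Quot I),
      zero = zero (S Quot I), add = add (S Quot I),
      smult = (\<lambda>s X. (I +>\<^bsub>S\<^esub> s) \<otimes>\<^bsub>S Quot I\<^esub> X)\<rparr>"

lemma (in cring) module_quotient_module:
  assumes "ideal I R"
  shows "module R (quotient_module R I)"
proof -
  interpret I: ideal I R by fact
  interpret Q: cring "R Quot I" by (rule I.quotient_is_cring) (rule is_cring)
  have h: "(+>) I \<in> ring_hom R (R Quot I)" by (rule I.rcos_ring_hom)
  note hs = ring_hom_closed [OF h] ring_hom_add [OF h] ring_hom_mult [OF h] ring_hom_one [OF h]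
  show ?thesis
  proof (rule moduleI)
    show "abelian_group (quotient_module R I)"
    proof (rule abelian_groupI)
      fix x assume "x \<in> carrier (quotient_module R I)"
      then show "\<exists>y\<in>carrier (quotient_module R I).
          y \<oplus>\<^bsub>quotient_module R I\<^esub> x = \<zero>\<^bsub>quotient_module R I\<^esub>"
        by (auto simp: quotient_module_def intro!: bexI [of _ "\<ominus>\<^bsub>R Quot I\<^esub> x"] Q.l_neg)
    qed (auto simp: quotient_module_def Q.a_ac)
  qed (auto simp: quotient_module_def hs Q.l_distr Q.r_distr Q.m_assoc is_cring)
qed

definition weak_sequence :: "('a, 'b) ring_scheme \<Rightarrow> 'a list \<Rightarrow> bool" where
  "weak_sequence S as \<longleftrightarrow> set as \<subseteq> carrier S \<and>
     (\<forall>i < length as.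
        as ! i \<notin> zero_divisors_on S (quotient_module S (Idl\<^bsub>S\<^esub> (set (take i as)))))"

definition grade :: "('a, 'b) ring_scheme \<Rightarrow> 'a set \<Rightarrow> enat" where
  "grade S I = Sup {enat (length as) | as. weak_sequence S as \<and> set as \<subseteq> I}"


section \<open>Polynomial grade\<close>

text \<open>A polynomial in the variables \<open>X\<^sub>0, X\<^sub>1, \<dots>\<close> is a finitely supported map from
  exponent vectors to coefficients; \<open>R[X\<^sub>1, \<dots>, X\<^sub>m]\<close> is realised as the subring of those
  polynomials that involve only \<open>X\<^sub>0, \<dots>, X\<^sub>m\<^sub>-\<^sub>1\<close>.\<close>

definition polys :: "nat \<Rightarrow> ((nat \<Rightarrow>\<^sub>0 nat) \<Rightarrow>\<^sub>0 'a::comm_ring_1) set" where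
  "polys m = {p. \<forall>t \<in> Poly_Mapping.keys p. Poly_Mapping.keys t \<subseteq> {..<m}}"

definition poly_ring :: "nat \<Rightarrow> ((nat \<Rightarrow>\<^sub>0 nat) \<Rightarrow>\<^sub>0 'a::comm_ring_1) ring" where
  "poly_ring m = cring_class_ops\<lparr>carrier := polys m\<rparr>"

lemma polys_times: "p \<in> polys m \<Longrightarrow> q \<in> polys m \<Longrightarrow> p * q \<in> polys m"
  unfolding polys_def
  using Poly_Mapping.keys_mult[of p q] Poly_Mapping.keys_add
  by (fastforce simp: subset_iff)
lemma cring_poly_ring:
  "cring (poly_ring m :: ((nat \<Rightarrow>\<^sub>0 nat) \<Rightarrow>\<^sub>0 'a::comm_ring_1) ring)"
  unfolding poly_ring_def
proof (rule cringI)
  show "abelian_group (cring_class_ops\<lparr>carrier := polys m :: ((nat \<Rightarrow>\<^sub>0 nat) \<Rightarrow>\<^sub>0 'a) set\<rparr>)"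
  proof (rule abelian_groupI, goal_cases)
    case (6 x)
    then have "-x \<in> polys m" by (simp add: polys_def cring_class_ops_def)
    then show ?case by (auto simp: cring_class_ops_def intro!: bexI[of _ "-x"])
  next
    case (1 x y)
    then show ?case
      using Poly_Mapping.keys_add[of x y]
      by (auto simp: cring_class_ops_def polys_def subset_iff)
  qed (auto simp: cring_class_ops_def polys_def algebra_simps)
  show "comm_monoid (cring_class_ops\<lparr>carrier := polys m :: ((nat \<Rightarrow>\<^sub>0 nat) \<Rightarrow>\<^sub>0 'a) set\<rparr>)"
    by (rule comm_monoidI) (auto simp: cring_class_ops_def polys_times algebra_simps, auto simp: polys_def)
qed (auto simp: cring_class_ops_def algebra_simps)

definition poly_extension :: "nat \<Rightarrow> 'a set \<Rightarrow> ((nat \<Rightarrow>\<^sub>0 nat) \<Rightarrow>\<^sub>0 'a::comm_ring_1) set" where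
  "poly_extension m I = {p \<in> polys m. \<forall>t. Poly_Mapping.lookup p t \<in> I}"

definition p_grade :: "'a::comm_ring_1 set \<Rightarrow> enat" where
  "p_grade I = lim (\<lambda>m. grade (poly_ring m) (poly_extension m I))"


section \<open>Operations on submodules of the quotient field\<close>

definition ideals :: "'a::comm_ring_1 set set" where
  "ideals = {J. ideal J cring_class_ops}"

definition Fbar :: "'a::idom fract set set" where
  "Fbar = {I. Modules.module.subspace (\<lambda>r x. to_fract r * x) I \<and> I \<noteq> {0}}"

definition colon :: "'a::idom fract set \<Rightarrow> 'a fract set \<Rightarrow> 'a fract set" where
  "colon I J = {x. \<forall>y \<in> J. x * y \<in> I}"

definition p_grade_op :: "nat \<Rightarrow> 'a::idom fract set \<Rightarrow> 'a fract set" where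
  "p_grade_op n I = (\<Union>J \<in> {J \<in> ideals. p_grade J \<ge> enat n}. colon I (to_fract ` J))"

definition e_op :: "'a::idom fract set \<Rightarrow> 'a fract set" where
  "e_op I = UNIV"

definition v_op :: "'a::idom fract set \<Rightarrow> 'a fract set" where
  "v_op I = colon (range to_fract) (colon (range to_fract) I)"

definition w_op :: "'a::idom fract set \<Rightarrow> 'a fract set" where
  "w_op I = (\<Union>J \<in> {J \<in> ideals. J \<noteq> {0} \<and> (\<exists>A. finite A \<and> J = Idl\<^bsub>cring_class_ops\<^esub> A) \<and>
                       v_op (to_fract ` J) = range to_fract}. colon I (to_fract ` J))"

end

theory Submission
  imports Defs
begin

text \<open>A weak sequence over \<open>R[X\<^sub>1, \<dots>, X\<^sub>m]\<close> stays weak after adjoining a variable, so the grades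
  increase with \<open>m\<close> and the polynomial grade is their supremum. A nonzero element is a weak
  sequence of length 1, and clearing denominators against an element of \<open>I\<close> gives
  \<open>(I : J) \<ni> x\<close> for a nonzero principal ideal \<open>J\<close>; this settles \<open>n \<le> 1\<close>.

  For \<open>n = 2\<close>, note that \<open>J\<^sub>v = R\<close> means \<open>(R : J) = R\<close>. If \<open>f, g\<close> is a weak sequence in
  \<open>J[X\<^sub>1, \<dots>, X\<^sub>m]\<close> and \<open>x\<close> multiplies all coefficients of \<open>f\<close> and \<open>g\<close> into \<open>R\<close>, then
  \<open>g (x f) = f (x g)\<close> forces \<open>f\<close> to divide \<open>x f\<close>, whence \<open>x \<in> R\<close>; so the coefficients generate a
  suitable ideal inside \<open>J\<close>. Conversely, if \<open>J\<close> is generated by \<open>a\<^sub>0, \<dots>, a\<^sub>n\<close> with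
  \<open>(R : J) = R\<close> and \<open>0 \<noteq> a \<in> J\<close>, then by McCoy's argument \<open>\<Sum> a\<^sub>i X\<^sup>i\<close> is a non-zero-divisor
  modulo \<open>a\<close>, so \<open>a, \<Sum> a\<^sub>i X\<^sup>i\<close> is a weak sequence.\<close>

section \<open>Weak sequences over polynomial rings\<close>

text \<open>A coset of \<open>g\<close> vanishes exactly when \<open>g\<close> lies in
  \<open>I\<close>, and \<open>s\<close> sends it to the coset of \<open>s \<otimes> g\<close>.
  Cosets can therefore be avoided from here on.\<close>

lemma (in cring) zero_divisors_on_quotient_module:
  assumes "ideal I R"
  shows "zero_divisors_on R (quotient_module R I) =
    {s \<in> carrier R. \<exists>g \<in> carrier R. g \<notin> I \<and> s \<otimes> g \<in> I}"
proof -
  interpret I: ideal I R by fact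
  have coset: "I +> x = I \<longleftrightarrow> x \<in> I" if "x \<in> carrier R" for x
    using that I.a_rcos_const I.rcos_const_imp_mem by blast
  have carrier: "carrier (quotient_module R I) = (+>) I ` carrier R"
    by (auto simp: quotient_module_def FactRing_def A_RCOSETS_def')
  have zero: "\<zero>\<^bsub>quotient_module R I\<^esub> = I"
    by (simp add: quotient_module_def FactRing_def)
  have smult: "s \<odot>\<^bsub>quotient_module R I\<^esub> (I +> g) = I +> (s \<otimes> g)"
    if "s \<in> carrier R" "g \<in> carrier R" for s g
    using that by (simp add: quotient_module_def FactRing_def I.rcoset_mult_add)
  show ?thesis
    by (auto simp: zero_divisors_on_def carrier zero smult coset)
qed

lemma poly_ring_simps [simp]:
  "carrier (poly_ring m) = polys m"
  "\<zero>\<^bsub>poly_ring m\<^esub> = 0"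
  "\<one>\<^bsub>poly_ring m\<^esub> = 1"
  "x \<oplus>\<^bsub>poly_ring m\<^esub> y = x + y"
  "x \<otimes>\<^bsub>poly_ring m\<^esub> y = x * y"
  by (simp_all add: poly_ring_def cring_class_ops_def)

lemma poly_mapping_sum_single:
  "(\<Sum>t\<in>Poly_Mapping.keys p. Poly_Mapping.single t (Poly_Mapping.lookup p t)) = p"
  by (rule poly_mapping_eqI)
    (auto simp: lookup_sum lookup_single when_def in_keys_iff)

lemma polys_0 [simp]: "0 \<in> polys m"
  and polys_1 [simp]: "1 \<in> polys m"
  by (simp_all add: polys_def)

lemma polys_add: "p \<in> polys m \<Longrightarrow> q \<in> polys m \<Longrightarrow> p + q \<in> polys m"
  unfolding polys_def using Poly_Mapping.keys_add[of p q] by blast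

lemma polys_uminus: "p \<in> polys m \<Longrightarrow> - p \<in> polys m"
  by (simp add: polys_def)

lemma polys_sum: "(\<And>i. i \<in> A \<Longrightarrow> f i \<in> polys m) \<Longrightarrow> sum f A \<in> polys m"
  by (induction A rule: infinite_finite_induct) (auto intro: polys_add)

lemma polys_single: "Poly_Mapping.keys t \<subseteq> {..<m} \<Longrightarrow> Poly_Mapping.single t c \<in> polys m"
  by (simp add: polys_def)

lemma polys_Suc: "p \<in> polys m \<Longrightarrow> p \<in> polys (Suc m)"
  by (fastforce simp: polys_def subset_iff less_Suc_eq)

text \<open>Closure under negation comes for free: it is multiplication by the constant -1.\<close>

lemma ideal_poly_ringI:
  assumes "I \<subseteq> polys m" and "0 \<in> I" and "\<And>p q. p \<in> I \<Longrightarrow> q \<in> I \<Longrightarrow> p + q \<in> I"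
    and mult: "\<And>p q. q \<in> polys m \<Longrightarrow> p \<in> I \<Longrightarrow> q * p \<in> I"
  shows "ideal I (poly_ring m)"
proof -
  interpret cring "poly_ring m :: ((nat \<Rightarrow>\<^sub>0 nat) \<Rightarrow>\<^sub>0 'a) ring"
    by (rule cring_poly_ring)
  have "- p \<in> I" if "p \<in> I" for p
    using mult[OF polys_uminus[OF polys_1] that] by simp
  moreover have "- p \<oplus>\<^bsub>poly_ring m\<^esub> p = \<zero>\<^bsub>poly_ring m\<^esub>" for p :: "(nat \<Rightarrow>\<^sub>0 nat) \<Rightarrow>\<^sub>0 'a"
    by simp
  ultimately have neg: "\<ominus>\<^bsub>poly_ring m\<^esub> p \<in> I" if "p \<in> I" for p
    using that assms(1) minus_equality[of "-p" p] polys_uminus[of p] by (auto simp: subset_iff)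
  have "subgroup I (add_monoid (poly_ring m))"
  proof (intro subgroup.intro)
    show "inv\<^bsub>add_monoid (poly_ring m)\<^esub> p \<in> I" if "p \<in> I" for p
      using neg[OF that] by (simp only: a_inv_def)
  qed (use assms in auto)
  moreover have "p * q \<in> I" if "q \<in> polys m" "p \<in> I" for p q
    using mult[OF that] by (simp add: mult.commute)
  ultimately show ?thesis
    using mult by (intro idealI[OF ring_axioms]) auto
qed

text \<open>The combinations form an ideal containing \<open>A\<close>, and any ideal containing
  \<open>A\<close> contains them. Having explicit multipliers lets membership be transported
  coefficient by coefficient when a variable is adjoined.\<close>

lemma genideal_poly_ring:
  assumes "finite A" "A \<subseteq> polys m"
  shows "Idl\<^bsub>poly_ring m\<^esub> A = {\<Sum>a\<in>A. q a * a | q. q ` A \<subseteq> polys m}" (is "_ = ?T")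
proof
  interpret cring "poly_ring m :: ((nat \<Rightarrow>\<^sub>0 nat) \<Rightarrow>\<^sub>0 'a) ring"
    by (rule cring_poly_ring)
  have "ideal ?T (poly_ring m)"
  proof (rule ideal_poly_ringI)
    show "?T \<subseteq> polys m"
      using assms by (auto intro!: polys_sum polys_times)
    show "0 \<in> ?T"
      by (auto intro!: exI[of _ "\<lambda>_. 0"])
  next
    fix x y assume "x \<in> ?T" "y \<in> ?T"
    then obtain q r where "q ` A \<subseteq> polys m" "r ` A \<subseteq> polys m"
      "x = (\<Sum>a\<in>A. q a * a)" "y = (\<Sum>a\<in>A. r a * a)" by blast
    then show "x + y \<in> ?T"
      by (intro CollectI exI[of _ "\<lambda>a. q a + r a"])
        (auto simp: sum.distrib distrib_right intro!: polys_add)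
  next
    fix x and y :: "(nat \<Rightarrow>\<^sub>0 nat) \<Rightarrow>\<^sub>0 'a"
    assume "y \<in> polys m" "x \<in> ?T"
    then obtain q where "q ` A \<subseteq> polys m" "x = (\<Sum>a\<in>A. q a * a)" by blast
    with \<open>y \<in> polys m\<close> show "y * x \<in> ?T"
      by (intro CollectI exI[of _ "\<lambda>a. y * q a"])
        (auto simp: sum_distrib_left mult.assoc intro!: polys_times)
  qed
  moreover have "A \<subseteq> ?T"
  proof
    fix b assume "b \<in> A"
    then have "b = (\<Sum>a\<in>A. (1 when a = b) * a)"
      using assms(1) by (simp add: when_def if_distrib[of "\<lambda>x. x * _"] cong: if_cong)
    then show "b \<in> ?T"
      by (intro CollectI exI[of _ "\<lambda>a. 1 when a = b"]) (auto simp: when_def)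
  qed
  ultimately show "Idl\<^bsub>poly_ring m\<^esub> A \<subseteq> ?T"
    by (rule genideal_minimal)
next
  interpret cring "poly_ring m :: ((nat \<Rightarrow>\<^sub>0 nat) \<Rightarrow>\<^sub>0 'a) ring"
    by (rule cring_poly_ring)
  interpret I: ideal "Idl\<^bsub>poly_ring m\<^esub> A" "poly_ring m"
    using assms(2) by (intro genideal_ideal) simp
  have gen: "A \<subseteq> Idl\<^bsub>poly_ring m\<^esub> A"
    using assms(2) by (intro genideal_self) simp
  have sum_closed: "sum f B \<in> Idl\<^bsub>poly_ring m\<^esub> A"
    if "\<And>b. b \<in> B \<Longrightarrow> f b \<in> Idl\<^bsub>poly_ring m\<^esub> A" for f and B :: "((nat \<Rightarrow>\<^sub>0 nat) \<Rightarrow>\<^sub>0 'a) set"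
    using that I.a_closed I.zero_closed
    by (induction B rule: infinite_finite_induct) auto
  have "q a * a \<in> Idl\<^bsub>poly_ring m\<^esub> A" if "a \<in> A" "q a \<in> polys m" for q a
    using that gen I.I_l_closed[of a "q a"] by auto
  then show "?T \<subseteq> Idl\<^bsub>poly_ring m\<^esub> A"
    by (auto intro!: sum_closed)
qed

lemma weak_sequence_poly_ring:
  "weak_sequence (poly_ring m) as \<longleftrightarrow> set as \<subseteq> polys m \<and>
    (\<forall>i < length as. \<forall>g \<in> polys m.
      as ! i * g \<in> Idl\<^bsub>poly_ring m\<^esub> (set (take i as)) \<longrightarrow> g \<in> Idl\<^bsub>poly_ring m\<^esub> (set (take i as)))"
proof (cases "set as \<subseteq> polys m")
  case True
  interpret cring "poly_ring m :: ((nat \<Rightarrow>\<^sub>0 nat) \<Rightarrow>\<^sub>0 'a) ring"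
    by (rule cring_poly_ring)
  have "ideal (Idl\<^bsub>poly_ring m\<^esub> (set (take i as))) (poly_ring m)" for i
    using True by (intro genideal_ideal) (auto dest: in_set_takeD)
  moreover have "as ! i \<in> polys m" if "i < length as" for i
    using True that by auto
  ultimately show ?thesis
    using True by (auto simp: weak_sequence_def zero_divisors_on_quotient_module)
qed (simp add: weak_sequence_def)

section \<open>Adjoining a variable\<close>

text \<open>The coefficient of \<open>X\<^sub>m\<^sup>k\<close>, as a polynomial in the other variables.\<close>

definition coeff_var ::
    "nat \<Rightarrow> nat \<Rightarrow> ((nat \<Rightarrow>\<^sub>0 nat) \<Rightarrow>\<^sub>0 'a::comm_ring_1) \<Rightarrow> ((nat \<Rightarrow>\<^sub>0 nat) \<Rightarrow>\<^sub>0 'a)" where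
  "coeff_var m k p = (\<Sum>t\<in>Poly_Mapping.keys p.
     Poly_Mapping.single (t - Poly_Mapping.single m k) (Poly_Mapping.lookup p t)
       when Poly_Mapping.lookup t m = k)"

text \<open>Extra exponents contribute zero. This gives polynomials with different supports a common
  index set, which is how additivity is proved.\<close>

lemma coeff_var_superset:
  assumes "finite T" "Poly_Mapping.keys p \<subseteq> T"
  shows "coeff_var m k p = (\<Sum>t\<in>T.
     Poly_Mapping.single (t - Poly_Mapping.single m k) (Poly_Mapping.lookup p t)
       when Poly_Mapping.lookup t m = k)"
  unfolding coeff_var_def using assms
  by (intro sum.mono_neutral_left) (auto simp: in_keys_iff)

lemma coeff_var_add: "coeff_var m k (p + q) = coeff_var m k p + coeff_var m k q"
proof -
  have "coeff_var m k r = (\<Sum>t\<in>Poly_Mapping.keys p \<union> Poly_Mapping.keys q.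
     Poly_Mapping.single (t - Poly_Mapping.single m k) (Poly_Mapping.lookup r t)
       when Poly_Mapping.lookup t m = k)" if "r \<in> {p, q, p + q}" for r
    using that Poly_Mapping.keys_add[of p q] by (intro coeff_var_superset) auto
  then show ?thesis
    by (simp add: sum.distrib[symmetric] lookup_add single_add when_add_distrib)
qed

lemma coeff_var_sum: "coeff_var m k (sum f A) = (\<Sum>i\<in>A. coeff_var m k (f i))"
  by (induction A rule: infinite_finite_induct) (auto simp: coeff_var_add coeff_var_def[of _ _ 0])

lemma coeff_var_single:
  "coeff_var m k (Poly_Mapping.single t c) =
    (Poly_Mapping.single (t - Poly_Mapping.single m k) c when Poly_Mapping.lookup t m = k)"
  by (simp add: coeff_var_def)

lemma coeff_var_polys:
  assumes "p \<in> polys (Suc m)"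
  shows "coeff_var m k p \<in> polys m"
  unfolding coeff_var_def
proof (rule polys_sum)
  fix t assume "t \<in> Poly_Mapping.keys p"
  then have "Poly_Mapping.keys t \<subseteq> {..<Suc m}"
    using assms by (simp add: polys_def)
  \<comment> \<open>Subtraction of exponents is truncated, but here it is exact: the exponent of X_m
    in \<open>t\<close> is \<open>k\<close>, so X_m disappears.\<close>
  then have "Poly_Mapping.keys (t - Poly_Mapping.single m k) \<subseteq> {..<m}" if "Poly_Mapping.lookup t m = k"
    using that by (auto simp: in_keys_iff lookup_minus lookup_single when_def subset_iff less_Suc_eq split: if_splits)
  then show "(Poly_Mapping.single (t - Poly_Mapping.single m k) (Poly_Mapping.lookup p t)
      when Poly_Mapping.lookup t m = k) \<in> polys m"
    by (auto simp: when_def intro!: polys_single)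
qed

text \<open>A factor free of X_m does not change exponents of X_m, so extracting a coefficient is
  linear over the smaller polynomial ring. Bilinearity reduces the claim to monomials.\<close>

lemma coeff_var_mult:
  assumes "f \<in> polys m"
  shows "coeff_var m k (f * p) = f * coeff_var m k p"
proof -
  let ?s = "Poly_Mapping.single" and ?l = "Poly_Mapping.lookup" and ?K = "Poly_Mapping.keys"
  have mono: "coeff_var m k (?s v c * ?s t d) = ?s v c * coeff_var m k (?s t d)"
    if "v \<in> ?K f" for v t and c d :: 'a
  proof -
    have "?l v m = 0"
      using assms that by (force simp: polys_def in_keys_iff)
    moreover from this have "v + t - ?s m (?l t m) = v + (t - ?s m (?l t m))"
      by (intro poly_mapping_eqI) (auto simp: lookup_add lookup_minus lookup_single when_def)
    ultimately show ?thesis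
      by (auto simp: mult_single coeff_var_single lookup_add when_def)
  qed
  have "coeff_var m k (f * p)
      = coeff_var m k (\<Sum>v\<in>?K f. \<Sum>t\<in>?K p. ?s v (?l f v) * ?s t (?l p t))"
    by (simp only: sum_product[symmetric] poly_mapping_sum_single)
  also have "\<dots> = (\<Sum>v\<in>?K f. \<Sum>t\<in>?K p. ?s v (?l f v) * coeff_var m k (?s t (?l p t)))"
    by (simp add: coeff_var_sum mono)
  also have "\<dots> = (\<Sum>v\<in>?K f. ?s v (?l f v)) * coeff_var m k (\<Sum>t\<in>?K p. ?s t (?l p t))"
    by (simp only: sum_product[symmetric] coeff_var_sum)
  finally show ?thesis
    by (simp only: poly_mapping_sum_single)
qed

lemma sum_coeff_var:
  "(\<Sum>k\<in>(\<lambda>t. Poly_Mapping.lookup t m) ` Poly_Mapping.keys p.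
      Poly_Mapping.single (Poly_Mapping.single m k) 1 * coeff_var m k p) = p"
proof -
  let ?s = "Poly_Mapping.single" and ?l = "Poly_Mapping.lookup" and ?K = "Poly_Mapping.keys p"
  have mono: "?s m (?l t m) + (t - ?s m (?l t m)) = t" for t
    by (intro poly_mapping_eqI) (auto simp: lookup_add lookup_minus lookup_single when_def)
  have "(\<Sum>k\<in>(\<lambda>t. ?l t m) ` ?K. ?s (?s m k) 1 * coeff_var m k p)
      = (\<Sum>k\<in>(\<lambda>t. ?l t m) ` ?K. \<Sum>t\<in>?K. ?s (?s m k + (t - ?s m k)) (?l p t) when ?l t m = k)"
    by (simp add: coeff_var_def sum_distrib_left mult_when mult_single)
  also have "\<dots> = (\<Sum>t\<in>?K. \<Sum>k\<in>(\<lambda>t. ?l t m) ` ?K. ?s (?s m k + (t - ?s m k)) (?l p t) when ?l t m = k)"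
    by (rule sum.swap)
  also have "\<dots> = (\<Sum>t\<in>?K. ?s t (?l p t))"
    by (intro sum.cong refl) (simp add: when_def mono)
  finally show ?thesis
    by (simp add: poly_mapping_sum_single)
qed

text \<open>The larger ring is free over the smaller one on the powers of X_m, so an extended ideal
  consists of the polynomials all of whose coefficients lie in the original ideal.\<close>

lemma genideal_poly_ring_Suc:
  assumes "finite A" "A \<subseteq> polys m" "p \<in> polys (Suc m)"
  shows "p \<in> Idl\<^bsub>poly_ring (Suc m)\<^esub> A \<longleftrightarrow> (\<forall>k. coeff_var m k p \<in> Idl\<^bsub>poly_ring m\<^esub> A)"
proof safe
  have A: "A \<subseteq> polys (Suc m)"
    using assms(2) polys_Suc by blast
  {
    fix k assume "p \<in> Idl\<^bsub>poly_ring (Suc m)\<^esub> A"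
    then obtain q where q: "q ` A \<subseteq> polys (Suc m)" "p = (\<Sum>a\<in>A. q a * a)"
      unfolding genideal_poly_ring[OF assms(1) A] by blast
    have "coeff_var m k p = (\<Sum>a\<in>A. coeff_var m k (q a) * a)"
      unfolding q(2) coeff_var_sum
    proof (intro sum.cong refl)
      fix a assume "a \<in> A"
      then have "coeff_var m k (a * q a) = a * coeff_var m k (q a)"
        using assms(2) by (intro coeff_var_mult) auto
      then show "coeff_var m k (q a * a) = coeff_var m k (q a) * a"
        by (simp add: mult.commute)
    qed
    moreover have "(\<lambda>a. coeff_var m k (q a)) ` A \<subseteq> polys m"
      using q(1) by (auto intro: coeff_var_polys)
    ultimately show "coeff_var m k p \<in> Idl\<^bsub>poly_ring m\<^esub> A"
      unfolding genideal_poly_ring[OF assms(1,2)]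
      by (intro CollectI exI[of _ "\<lambda>a. coeff_var m k (q a)"]) blast
  next
    assume "\<forall>k. coeff_var m k p \<in> Idl\<^bsub>poly_ring m\<^esub> A"
    then have "\<forall>k. \<exists>q. q ` A \<subseteq> polys m \<and> coeff_var m k p = (\<Sum>a\<in>A. q a * a)"
      unfolding genideal_poly_ring[OF assms(1,2)] by blast
    from choice[OF this] obtain q where q: "\<And>k. q k ` A \<subseteq> polys m"
        "\<And>k. coeff_var m k p = (\<Sum>a\<in>A. q k a * a)"
      by blast
    \<comment> \<open>The finitely many exponents of X_m in \<open>p\<close>. Summing over them
      merges the multipliers chosen for each power into one multiplier per generator.\<close>
    define K where "K = (\<lambda>t. Poly_Mapping.lookup t m) ` Poly_Mapping.keys p"
    define X where "X k = (Poly_Mapping.single (Poly_Mapping.single m k) 1 :: (nat \<Rightarrow>\<^sub>0 nat) \<Rightarrow>\<^sub>0 'a)" for k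
    have "p = (\<Sum>k\<in>K. X k * (\<Sum>a\<in>A. q k a * a))"
      using sum_coeff_var[of m p] by (simp add: q(2) K_def X_def)
    also have "\<dots> = (\<Sum>a\<in>A. (\<Sum>k\<in>K. X k * q k a) * a)"
      unfolding sum_distrib_left sum_distrib_right mult.assoc by (rule sum.swap)
    finally have "p = (\<Sum>a\<in>A. (\<Sum>k\<in>K. X k * q k a) * a)" .
    moreover have "(\<lambda>a. \<Sum>k\<in>K. X k * q k a) ` A \<subseteq> polys (Suc m)"
    proof -
      have "X k \<in> polys (Suc m)" for k
        unfolding X_def by (rule polys_single) auto
      moreover have "q k a \<in> polys (Suc m)" if "a \<in> A" for k a
        using q(1) that by (intro polys_Suc) blast
      ultimately show ?thesis
        by (auto intro!: polys_sum polys_times)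
    qed
    ultimately show "p \<in> Idl\<^bsub>poly_ring (Suc m)\<^esub> A"
      unfolding genideal_poly_ring[OF assms(1) A]
      by (intro CollectI exI[of _ "\<lambda>a. \<Sum>k\<in>K. X k * q k a"]) blast
  }
qed

text \<open>The entries of the sequence are free of X_m, so cancellation modulo the preceding
  entries can be carried out on each coefficient separately.\<close>

lemma weak_sequence_poly_ring_Suc:
  assumes "weak_sequence (poly_ring m) as"
  shows "weak_sequence (poly_ring (Suc m)) as"
  unfolding weak_sequence_poly_ring
proof (intro conjI allI impI ballI)
  have as: "set as \<subseteq> polys m"
    using assms by (simp add: weak_sequence_poly_ring)
  then show as': "set as \<subseteq> polys (Suc m)"
    using polys_Suc by blast
  fix i g
  assume i: "i < length as" and g: "g \<in> polys (Suc m)"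
    and "as ! i * g \<in> Idl\<^bsub>poly_ring (Suc m)\<^esub> (set (take i as))"
  moreover have T: "set (take i as) \<subseteq> polys m"
    using as by (auto dest: in_set_takeD)
  moreover have ai: "as ! i \<in> polys m"
    using as i by auto
  ultimately have "\<forall>k. as ! i * coeff_var m k g \<in> Idl\<^bsub>poly_ring m\<^esub> (set (take i as))"
    using genideal_poly_ring_Suc[of "set (take i as)" m "as ! i * g"] polys_times[OF polys_Suc[OF ai] g]
    by (simp add: coeff_var_mult)
  then have "\<forall>k. coeff_var m k g \<in> Idl\<^bsub>poly_ring m\<^esub> (set (take i as))"
    using assms i coeff_var_polys[OF g] by (auto simp: weak_sequence_poly_ring)
  then show "g \<in> Idl\<^bsub>poly_ring (Suc m)\<^esub> (set (take i as))"
    using g T by (simp add: genideal_poly_ring_Suc)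
qed

section \<open>Polynomial grade as a supremum of lengths\<close>

lemma p_grade_eq_SUP: "p_grade J = (SUP m. grade (poly_ring m) (poly_extension m J))"
proof -
  have "poly_extension m J \<subseteq> poly_extension (Suc m) J" for m
    by (auto simp: poly_extension_def polys_Suc)
  then have "incseq (\<lambda>m. grade (poly_ring m) (poly_extension m J))"
    unfolding incseq_Suc_iff grade_def
    using weak_sequence_poly_ring_Suc by (intro allI Sup_subset_mono) blast
  \<comment> \<open>Monotonicity makes the sequence converge to its supremum, so \<open>lim\<close>
    denotes a genuine limit.\<close>
  then show ?thesis
    unfolding p_grade_def by (intro limI LIMSEQ_SUP)
qed

lemma weak_sequence_take: "weak_sequence S as \<Longrightarrow> weak_sequence S (take n as)"
  unfolding weak_sequence_def by (auto simp: min_def dest: in_set_takeD)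

text \<open>A finite lower bound on a supremum of lengths is reached by some sequence, and prefixes
  of weak sequences are weak, so the length can be made exactly \<open>n\<close>.\<close>

lemma p_grade_ge_iff:
  "p_grade J \<ge> enat n \<longleftrightarrow>
    (\<exists>m as. length as = n \<and> weak_sequence (poly_ring m) as \<and> set as \<subseteq> poly_extension m J)"
proof
  assume ge: "p_grade J \<ge> enat n"
  show "\<exists>m as. length as = n \<and> weak_sequence (poly_ring m) as \<and> set as \<subseteq> poly_extension m J"
  proof (cases n)
    case 0
    then show ?thesis by (auto simp: weak_sequence_def)
  next
    case (Suc k)
    \<comment> \<open>The strict form of the bound yields an actual member of the supremum exceeding
      \<open>k\<close>, hence of length at least \<open>n\<close>.\<close>
    then have "enat k < (SUP m. grade (poly_ring m) (poly_extension m J))"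
      using ge by (simp add: p_grade_eq_SUP Suc_ile_eq)
    then obtain m as where as: "n \<le> length as"
      "weak_sequence (poly_ring m) as" "set as \<subseteq> poly_extension m J"
      using Suc by (auto simp: less_SUP_iff grade_def less_Sup_iff Suc_le_eq)
    then show ?thesis
      by (intro exI[of _ m] exI[of _ "take n as"])
        (auto simp: weak_sequence_take dest: in_set_takeD)
  qed
next
  assume "\<exists>m as. length as = n \<and> weak_sequence (poly_ring m) as \<and> set as \<subseteq> poly_extension m J"
  then obtain m as where "length as = n" "weak_sequence (poly_ring m) as" "set as \<subseteq> poly_extension m J"
    by blast
  then have "enat n \<le> grade (poly_ring m) (poly_extension m J)"
    unfolding grade_def by (intro Sup_upper) blast
  then show "p_grade J \<ge> enat n"
    unfolding p_grade_eq_SUP by (rule order_trans) (rule SUP_upper, simp)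
qed

section \<open>Cancelling a polynomial of unit content modulo an element\<close>

lemma lookup_mult_sum:
  "Poly_Mapping.lookup (p * q) k =
    (\<Sum>(v, w)\<in>Poly_Mapping.keys p \<times> Poly_Mapping.keys q.
      Poly_Mapping.lookup p v * Poly_Mapping.lookup q w when v + w = k)"
proof -
  let ?s = "\<lambda>p t. Poly_Mapping.single t (Poly_Mapping.lookup p t)"
  have "p * q = (\<Sum>v\<in>Poly_Mapping.keys p. \<Sum>w\<in>Poly_Mapping.keys q. ?s p v * ?s q w)"
    by (simp only: sum_product[symmetric] poly_mapping_sum_single)
  then show ?thesis
    by (simp add: mult_single lookup_sum lookup_single sum.cartesian_product case_prod_unfold)
qed

lemma single_eq_0_iff [simp]: "Poly_Mapping.single t c = 0 \<longleftrightarrow> c = 0"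
  by (metis lookup_single_eq lookup_zero single_zero)

lemma lookup_single_0_mult:
  "Poly_Mapping.lookup (Poly_Mapping.single 0 c * p) t = c * Poly_Mapping.lookup p t"
  by (simp add: mult_map_scale_conv_mult[symmetric] map.rep_eq when_def)

text \<open>McCoy's argument: if \<open>r\<close> is the largest exponent for which \<open>f\<^sub>r g\<close> does not vanish
  modulo \<open>a\<close>, then the top term of \<open>g\<close> contributes \<open>0\<close> to \<open>f\<^sub>r g\<close>, so \<open>f\<^sub>r g\<close> without it
  has fewer terms than \<open>g\<close> and is still annihilated by \<open>f\<close> modulo \<open>a\<close>.\<close>

lemma coeffs_dvd_mult_cancel:
  fixes f g :: "'m::{ordered_cancel_comm_monoid_add, linorder} \<Rightarrow>\<^sub>0 'a::comm_ring_1"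
  assumes cancel: "\<And>c. (\<forall>s. a dvd Poly_Mapping.lookup f s * c) \<Longrightarrow> a dvd c"
    and "\<forall>t. a dvd Poly_Mapping.lookup (f * g) t"
  shows "\<forall>t. a dvd Poly_Mapping.lookup g t"
  using assms(2)
proof (induction "card (Poly_Mapping.keys g)" arbitrary: g rule: less_induct)
  case less
  let ?s = "Poly_Mapping.single" and ?l = "Poly_Mapping.lookup" and ?K = "Poly_Mapping.keys"
  have "a dvd ?l f s * ?l g t" for s t
  proof (rule ccontr)
    assume nd: "\<not> a dvd ?l f s * ?l g t"
    define S where "S = {s. \<exists>t. \<not> a dvd ?l f s * ?l g t}"
    have "S \<subseteq> ?K f"
      by (auto simp: S_def in_keys_iff)
    then have S: "finite S" "S \<noteq> {}"
      using nd finite_subset[OF _ finite_keys] by (auto simp: S_def)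
    define r where "r = Max S"
    have "r \<in> S"
      using S by (simp add: r_def)
    then have r: "r \<in> ?K f"
      using \<open>S \<subseteq> ?K f\<close> by blast
    have above: "a dvd ?l f v * ?l g w" if "r < v" for v w
    proof -
      have "v \<notin> S"
        using that S(1) Max_ge leD unfolding r_def by blast
      then show ?thesis by (simp add: S_def)
    qed
    have "?K g \<noteq> {}"
      using nd by (auto simp: in_keys_iff)
    define d where "d = Max (?K g)"
    have d: "d \<in> ?K g" "\<And>w. w \<in> ?K g \<Longrightarrow> w \<le> d"
      using \<open>?K g \<noteq> {}\<close> by (simp_all add: d_def)
    \<comment> \<open>Compare coefficients of \<open>f * g\<close> at \<open>r + d\<close>. A pair
      with \<open>v < r\<close> has too small a sum, since \<open>w \<le> d\<close>; a pair with
      \<open>v > r\<close> contributes a multiple of \<open>a\<close> by the choice of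
      \<open>r\<close>. Only the pair \<open>(r, d)\<close> remains.\<close>
    have "a dvd ?l f r * ?l g d"
    proof -
      have "a dvd (?l f v * ?l g w when v + w = r + d)"
        if "(v, w) \<in> ?K f \<times> ?K g - {(r, d)}" for v w
      proof (cases v r rule: linorder_cases)
        case less
        then have "v + w < r + d"
          using that d(2) by (intro add_less_le_mono) auto
        then show ?thesis by simp
      next
        case equal
        then show ?thesis
          using that by simp
      next
        case greater
        then show ?thesis
          using above by (simp add: when_def)
      qed
      then have "a dvd (\<Sum>(v, w)\<in>?K f \<times> ?K g - {(r, d)}. ?l f v * ?l g w when v + w = r + d)"
        by (intro dvd_sum) auto
      moreover have "?l (f * g) (r + d) = ?l f r * ?l g d
          + (\<Sum>(v, w)\<in>?K f \<times> ?K g - {(r, d)}. ?l f v * ?l g w when v + w = r + d)"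
        unfolding lookup_mult_sum using r d(1) by (subst sum.remove[of _ "(r, d)"]) auto
      ultimately show ?thesis
        using less.prems[rule_format, of "r + d"] by (simp add: dvd_add_left_iff)
    qed
    define h where "h = ?s 0 (?l f r) * (g - ?s d (?l g d))"
    have h: "?l h t = (?l f r * ?l g t when t \<noteq> d)" for t
      by (simp add: h_def lookup_single_0_mult lookup_minus lookup_single when_def)
    have "?K h \<subseteq> ?K g - {d}"
      by (auto simp: in_keys_iff h)
    then have "card (?K h) \<le> card (?K g - {d})"
      by (intro card_mono) auto
    also have "\<dots> < card (?K g)"
      using d(1) by (intro card_Diff1_less) auto
    finally have "card (?K h) < card (?K g)" .
    \<comment> \<open>Removing the top term changes \<open>f * g\<close>, scaled by the coefficient
      of \<open>f\<close> at \<open>r\<close>, only by a multiple of the coefficient product just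
      shown divisible by \<open>a\<close>.\<close>
    moreover have "f * h = ?s 0 (?l f r) * (f * g) - ?s 0 (?l f r * ?l g d) * (?s d 1 * f)"
    proof -
      have "?s 0 (?l f r * ?l g d) * (?s d 1 * f) = ?s 0 (?l f r) * ?s d (?l g d) * f"
        by (simp add: mult_single mult.assoc[symmetric])
      then show ?thesis
        unfolding h_def by (simp add: algebra_simps)
    qed
    then have "\<forall>t. a dvd ?l (f * h) t"
      using less.prems \<open>a dvd ?l f r * ?l g d\<close>
      by (auto simp: lookup_minus lookup_single_0_mult intro!: dvd_diff)
    ultimately have "\<forall>t. a dvd ?l h t"
      by (rule less.hyps)
    then have "a dvd ?l f r * ?l g t" for t
      using \<open>a dvd ?l f r * ?l g d\<close> h[of t] by (cases "t = d") (auto dest!: spec[of _ t])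
    then show False
      using \<open>r \<in> S\<close> by (auto simp: S_def)
  qed
  then show ?case
    using cancel by blast
qed

lemma polys_dvd_coeffs:
  assumes "p \<in> polys m" "\<forall>t. a dvd Poly_Mapping.lookup p t"
  obtains q where "q \<in> polys m" "p = Poly_Mapping.single 0 a * q"
proof -
  obtain d where d: "\<And>t. Poly_Mapping.lookup p t = a * d t"
    using assms(2) unfolding dvd_def by metis
  \<comment> \<open>Quotients are taken only on the support of \<open>p\<close>; this keeps
    \<open>q\<close> finitely supported and free of new variables, even for \<open>a = 0\<close>,
    when \<open>d\<close> may be arbitrary.\<close>
  define q where "q = (\<Sum>t\<in>Poly_Mapping.keys p. Poly_Mapping.single t (d t))"
  have "Poly_Mapping.single 0 a * q
      = (\<Sum>t\<in>Poly_Mapping.keys p. Poly_Mapping.single t (Poly_Mapping.lookup p t))"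
    by (simp add: q_def sum_distrib_left mult_single d)
  then have "p = Poly_Mapping.single 0 a * q"
    by (simp add: poly_mapping_sum_single)
  moreover have "q \<in> polys m"
    unfolding q_def using assms(1) by (intro polys_sum polys_single) (simp add: polys_def)
  ultimately show ?thesis
    using that by blast
qed

section \<open>Weak sequences of length one and two\<close>

lemma genideal_poly_ring_singleton:
  assumes "f \<in> polys m"
  shows "Idl\<^bsub>poly_ring m\<^esub> {f} = (*) f ` polys m"
proof -
  have "q * f \<in> (*) f ` polys m" if "q \<in> polys m" for q
    using that by (auto simp: mult.commute[of q])
  moreover have "\<exists>q'. f * q = q' f * f \<and> q' f \<in> polys m" if "q \<in> polys m" for q
    using that by (intro exI[of _ "\<lambda>_. q"]) (simp add: mult.commute)
  ultimately show ?thesis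
    using assms by (subst genideal_poly_ring) auto
qed

text \<open>The empty list generates the zero ideal, and the polynomial ring is a domain.
  Conversely, \<open>f = 0\<close> would multiply 1 into the zero ideal.\<close>

lemma weak_sequence_poly_ring_1:
  fixes f :: "(nat \<Rightarrow>\<^sub>0 nat) \<Rightarrow>\<^sub>0 'a::idom"
  shows "weak_sequence (poly_ring m) [f] \<longleftrightarrow> f \<in> polys m \<and> f \<noteq> 0"
  by (auto simp: weak_sequence_poly_ring genideal_poly_ring) (metis polys_1 zero_neq_one)

lemma weak_sequence_poly_ring_2:
  fixes f g :: "(nat \<Rightarrow>\<^sub>0 nat) \<Rightarrow>\<^sub>0 'a::idom"
  shows "weak_sequence (poly_ring m) [f, g] \<longleftrightarrow> f \<in> polys m \<and> f \<noteq> 0 \<and> g \<in> polys m \<and>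
    (\<forall>h \<in> polys m. g * h \<in> (*) f ` polys m \<longrightarrow> h \<in> (*) f ` polys m)"
proof -
  have "weak_sequence (poly_ring m) [f, g] \<longleftrightarrow> weak_sequence (poly_ring m) [f] \<and> g \<in> polys m \<and>
    (\<forall>h \<in> polys m. g * h \<in> Idl\<^bsub>poly_ring m\<^esub> {f} \<longrightarrow> h \<in> Idl\<^bsub>poly_ring m\<^esub> {f})"
    by (auto simp: weak_sequence_poly_ring less_Suc_eq)
  then show ?thesis
    by (auto simp: weak_sequence_poly_ring_1 genideal_poly_ring_singleton)
qed

section \<open>Ideals with trivial inverse and polynomial grade\<close>

lemma zero_mem_ideals: "J \<in> ideals \<Longrightarrow> 0 \<in> J"
  by (auto simp: ideals_def zero_class dest: additive_subgroup.zero_closed[OF ideal.axioms(1)])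

lemma genideal_mem_ideals: "Idl\<^bsub>cring_class_ops\<^esub> A \<in> ideals"
  unfolding ideals_def
  by (simp add: ring.genideal_ideal[OF cring.axioms(1)[OF cring_class]] carrier_class subset_iff)

lemma subset_genideal: "A \<subseteq> Idl\<^bsub>cring_class_ops\<^esub> A"
  by (rule ring.genideal_self[OF cring.axioms(1)[OF cring_class]]) (simp add: carrier_class subset_iff)

lemma genideal_subset: "J \<in> ideals \<Longrightarrow> A \<subseteq> J \<Longrightarrow> Idl\<^bsub>cring_class_ops\<^esub> A \<subseteq> J"
  by (simp add: ideals_def ring.genideal_minimal[OF cring.axioms(1)[OF cring_class]])

text \<open>This is the colon ideal of \<open>c\<close> into the principal ideal of
  \<open>a\<close>. A divisibility condition checked on generators thereby extends to the ideal they
  generate.\<close>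

lemma colon_dvd_mem_ideals: "{y. a dvd c * y} \<in> ideals"
proof -
  have "subgroup {y. a dvd c * y} (add_monoid cring_class_ops)"
  proof (intro subgroup.intro)
    show "inv\<^bsub>add_monoid cring_class_ops\<^esub> y \<in> {y. a dvd c * y}" if "y \<in> {y. a dvd c * y}" for y
      using that uminus_class[of y, unfolded a_inv_def]
      by (simp only: mem_Collect_eq mult_minus_right dvd_minus_iff)
  qed (auto simp: carrier_class zero_class plus_class distrib_left)
  moreover have "a dvd c * (x * y)" "a dvd c * (y * x)" if "a dvd c * y" for x y
    using dvd_mult[OF that, of x] by (simp_all add: ac_simps)
  ultimately show ?thesis
    unfolding ideals_def
    by (auto intro!: idealI simp: cring_class.ring_axioms times_class)
qed

lemma principal_mem_ideals: "range ((*) a) \<in> ideals"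
proof -
  have "range ((*) a) = {y. a dvd 1 * y}"
    by (auto simp: dvd_def)
  then show ?thesis
    using colon_dvd_mem_ideals[of a 1] by simp
qed

lemma ex_to_fract_quotient: "\<exists>a b. b \<noteq> 0 \<and> x = to_fract a / to_fract b"
  by (cases x) (metis Fract_conv_to_fract)

text \<open>Both sides say that the inverse of \<open>A\<close> lies in R: if it does, it equals R,
  whose own inverse is R. Writing a field element as \<open>c / a\<close> turns this into
  divisibility inside R.\<close>

lemma v_op_eq_range_iff:
  "v_op (to_fract ` A) = range to_fract \<longleftrightarrow>
    (\<forall>a c. a \<noteq> 0 \<longrightarrow> (\<forall>y\<in>A. a dvd c * y) \<longrightarrow> a dvd c)"
proof -
  have frac: "to_fract c / to_fract a * to_fract y \<in> range to_fract \<longleftrightarrow> a dvd c * y"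
    if "a \<noteq> 0" for a c y :: 'a
  proof -
    have "to_fract c / to_fract a * to_fract y = to_fract d \<longleftrightarrow> c * y = a * d" for d
    proof -
      have "to_fract c / to_fract a * to_fract y = to_fract d \<longleftrightarrow> to_fract (c * y) = to_fract (a * d)"
        using that by (simp add: field_simps)
      then show ?thesis by (simp only: to_fract_eq_iff)
    qed
    then show ?thesis
      by (auto simp: dvd_def)
  qed
  let ?R = "range (to_fract :: 'a \<Rightarrow> _)"
  have one: "1 \<in> ?R"
    using to_fract_1 by (metis rangeI)
  have mult: "x * y \<in> ?R" if "x \<in> ?R" "y \<in> ?R" for x y
    using that by (auto simp flip: to_fract_mult)
  have "v_op (to_fract ` A) = ?R \<longleftrightarrow> colon ?R (to_fract ` A) \<subseteq> ?R"
  proof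
    assume "v_op (to_fract ` A) = ?R"
    \<comment> \<open>Applied to 1, membership in the double inverse says that every element of the
      inverse lies in R.\<close>
    then have "1 \<in> colon ?R (colon ?R (to_fract ` A))"
      using one by (simp add: v_op_def)
    then show "colon ?R (to_fract ` A) \<subseteq> ?R"
      by (auto simp: colon_def)
  next
    assume sub: "colon ?R (to_fract ` A) \<subseteq> ?R"
    moreover have "?R \<subseteq> colon ?R (to_fract ` A)"
      using mult by (auto simp: colon_def)
    ultimately have "v_op (to_fract ` A) = colon ?R ?R"
      unfolding v_op_def by simp
    also have "\<dots> = ?R"
      using mult one by (auto simp: colon_def) (metis mult.right_neutral)
    finally show "v_op (to_fract ` A) = ?R" .
  qed
  also have "\<dots> \<longleftrightarrow> (\<forall>a c. a \<noteq> 0 \<longrightarrow> (\<forall>y\<in>A. a dvd c * y) \<longrightarrow> a dvd c)"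
  proof safe
    fix a c :: 'a
    assume "colon ?R (to_fract ` A) \<subseteq> ?R" "a \<noteq> 0" "\<forall>y\<in>A. a dvd c * y"
    moreover from this have "to_fract c / to_fract a \<in> colon ?R (to_fract ` A)"
      by (simp add: colon_def frac del: times_divide_eq_left)
    ultimately have "to_fract c / to_fract a \<in> ?R"
      by blast
    then show "a dvd c"
      using frac[OF \<open>a \<noteq> 0\<close>, of c 1] by simp
  next
    fix x assume *: "\<forall>a c. a \<noteq> 0 \<longrightarrow> (\<forall>y\<in>A. a dvd c * y) \<longrightarrow> a dvd c" "x \<in> colon ?R (to_fract ` A)"
    obtain a c where "a \<noteq> 0" "x = to_fract c / to_fract a"
      using ex_to_fract_quotient by blast
    with *(2) have "\<forall>y\<in>A. a dvd c * y"
      by (simp add: colon_def frac del: times_divide_eq_left)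
    with *(1) \<open>a \<noteq> 0\<close> have "a dvd c"
      by blast
    then show "x \<in> ?R"
      using frac[OF \<open>a \<noteq> 0\<close>, of c 1] \<open>x = _\<close> by simp
  qed
  finally show ?thesis .
qed

lemma single_mem_poly_extension:
  "0 \<in> J \<Longrightarrow> a \<in> J \<Longrightarrow> Poly_Mapping.single 0 a \<in> poly_extension m J"
  by (auto simp: poly_extension_def lookup_single when_def intro: polys_single)

section \<open>Ideals of polynomial grade at least one or two\<close>

lemma p_grade_ge_1:
  fixes J :: "'a::idom set"
  assumes "J \<in> ideals" "a \<in> J" "a \<noteq> 0"
  shows "enat 1 \<le> p_grade J"
  unfolding p_grade_ge_iff
proof (intro exI conjI)
  show "weak_sequence (poly_ring 0) [Poly_Mapping.single 0 a]"
    using assms(3) by (simp add: weak_sequence_poly_ring_1 polys_single)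
qed (use assms in \<open>simp_all add: single_mem_poly_extension zero_mem_ideals\<close>)

lemma p_grade_ge_2I:
  fixes A :: "'a::idom set"
  assumes "finite A" and J: "J = Idl\<^bsub>cring_class_ops\<^esub> A" "J \<noteq> {0}"
    and v: "v_op (to_fract ` J) = range to_fract"
  shows "enat 2 \<le> p_grade J"
proof -
  have ideal: "J \<in> ideals" and A: "A \<subseteq> J"
    using J by (simp_all add: genideal_mem_ideals subset_genideal)
  then obtain a where a: "a \<in> J" "a \<noteq> 0"
    using J(2) zero_mem_ideals by blast
  \<comment> \<open>An injective numbering gives each generator its own power of a single variable,
    so that every generator occurs as a coefficient of \<open>f\<close>.\<close>
  obtain n where n: "inj_on n A" "n ` A \<subseteq> (UNIV :: nat set)"
    using finite_imp_inj_to_nat_seg[OF assms(1)] by blast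
  define x where "x b = Poly_Mapping.single (0 :: nat) (n b)" for b
  define f where "f = (\<Sum>b\<in>A. Poly_Mapping.single (x b) b)"
  define c where "c = (Poly_Mapping.single 0 a :: (nat \<Rightarrow>\<^sub>0 nat) \<Rightarrow>\<^sub>0 'a)"
  have x_eq: "x b = x b' \<longleftrightarrow> b = b'" if "b \<in> A" "b' \<in> A" for b b'
    using n(1) that by (metis x_def inj_onD lookup_single_eq)
  have f_x: "Poly_Mapping.lookup f (x b) = b" if "b \<in> A" for b
    using assms(1) that by (simp add: f_def lookup_sum lookup_single x_eq when_def cong: sum.cong)
  have f_coeff: "Poly_Mapping.lookup f t \<in> insert 0 A" for t
  proof (cases "t \<in> x ` A")
    case False
    then show ?thesis
      by (auto simp: f_def lookup_sum lookup_single when_def intro!: sum.neutral)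
  qed (use f_x in auto)
  have f: "f \<in> polys 1" and c: "c \<in> polys 1" "c \<noteq> 0"
    using a(2) by (auto simp: f_def c_def x_def intro!: polys_sum polys_single split: if_splits)
  \<comment> \<open>This is the hypothesis of McCoy's argument: divisibility passes from the
    generators to all of \<open>J\<close>, where the trivial inverse applies.\<close>
  have cancel: "a dvd d" if "\<forall>s. a dvd Poly_Mapping.lookup f s * d" for d
  proof -
    have "A \<subseteq> {y. a dvd d * y}"
      using that f_x by (auto simp: mult.commute) (metis mult.commute)
    then have "J \<subseteq> {y. a dvd d * y}"
      unfolding J(1) by (intro genideal_subset colon_dvd_mem_ideals)
    then show ?thesis
      using v a(2) unfolding v_op_eq_range_iff by blast
  qed
  have "h \<in> (*) c ` polys 1" if h: "h \<in> polys 1" "f * h \<in> (*) c ` polys 1" for h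
  proof -
    have "\<forall>t. a dvd Poly_Mapping.lookup (f * h) t"
      using h(2) by (auto simp: c_def lookup_single_0_mult)
    then have "\<forall>t. a dvd Poly_Mapping.lookup h t"
      using coeffs_dvd_mult_cancel[where f = f and a = a and g = h] cancel by blast
    then show ?thesis
      using polys_dvd_coeffs[OF h(1)] unfolding c_def by blast
  qed
  then have "weak_sequence (poly_ring 1) [c, f]"
    using f c by (simp add: weak_sequence_poly_ring_2)
  moreover have "c \<in> poly_extension 1 J"
    using a(1) ideal by (simp add: c_def single_mem_poly_extension zero_mem_ideals)
  moreover have "f \<in> poly_extension 1 J"
  proof -
    have "Poly_Mapping.lookup f t \<in> J" for t
      using f_coeff[of t] A zero_mem_ideals[OF ideal] by auto
    then show ?thesis
      using f by (simp add: poly_extension_def)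
  qed
  ultimately show ?thesis
    unfolding p_grade_ge_iff by (intro exI[of _ 1] exI[of _ "[c, f]"]) simp
qed

lemma p_grade_ge_2E:
  fixes J :: "'a::idom set"
  assumes "enat 2 \<le> p_grade J"
  obtains A where "finite A" "A \<subseteq> J" "Idl\<^bsub>cring_class_ops\<^esub> A \<noteq> {0}"
    "v_op (to_fract ` (Idl\<^bsub>cring_class_ops\<^esub> A)) = range to_fract"
proof -
  let ?l = "Poly_Mapping.lookup" and ?K = "Poly_Mapping.keys"
  obtain m as where "length as = 2" "weak_sequence (poly_ring m) as" "set as \<subseteq> poly_extension m J"
    using assms unfolding p_grade_ge_iff by blast
  then obtain f g where fg: "weak_sequence (poly_ring m) [f, g]"
    "f \<in> poly_extension m J" "g \<in> poly_extension m J"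
    by (auto simp: numeral_2_eq_2 length_Suc_conv)
  then have f: "f \<in> polys m" "f \<noteq> 0" and g: "g \<in> polys m"
    and weak: "\<And>h. h \<in> polys m \<Longrightarrow> g * h \<in> (*) f ` polys m \<Longrightarrow> h \<in> (*) f ` polys m"
    by (auto simp: weak_sequence_poly_ring_2)
  \<comment> \<open>\<open>J\<close> itself may fail to be finitely generated; the supports of
    \<open>f\<close> and \<open>g\<close> are finite and their coefficients lie in
    \<open>J\<close>.\<close>
  define A where "A = ?l f ` ?K f \<union> ?l g ` ?K g"
  have A: "A \<subseteq> Idl\<^bsub>cring_class_ops\<^esub> A"
    by (rule subset_genideal)
  have "b dvd a" if b: "b \<noteq> 0" and dvd: "\<forall>y\<in>Idl\<^bsub>cring_class_ops\<^esub> A. b dvd a * y" for a b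
  proof -
    let ?c = "\<lambda>a. Poly_Mapping.single 0 a :: (nat \<Rightarrow>\<^sub>0 nat) \<Rightarrow>\<^sub>0 'a"
    have c: "?c a \<in> polys m" "?c b \<noteq> 0"
      using b by (simp_all add: polys_single)
    have "b dvd a * y" if "y \<in> A" for y
      using A dvd that by blast
    then have "b dvd a * ?l p t" if "p \<in> {f, g}" for p t
      using that by (cases "t \<in> ?K p") (auto simp: A_def in_keys_iff)
    then have "\<forall>t. b dvd ?l (?c a * f) t" "\<forall>t. b dvd ?l (?c a * g) t"
      by (simp_all add: lookup_single_0_mult)
    \<comment> \<open>\<open>u\<close> and \<open>w\<close> are x f and x g for x = a/b, obtained
      without leaving the polynomial ring over R.\<close>
    then obtain u w where u: "u \<in> polys m" "?c a * f = ?c b * u"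
      and w: "w \<in> polys m" "?c a * g = ?c b * w"
      using polys_dvd_coeffs polys_times[OF c(1) f(1)] polys_times[OF c(1) g] by metis
    have "?c b * (g * u) = g * (?c a * f)"
      by (simp only: u(2) mult.left_commute)
    also have "\<dots> = f * (?c a * g)"
      by (simp only: mult_ac)
    also have "\<dots> = ?c b * (f * w)"
      by (simp only: w(2) mult.left_commute)
    finally have "g * u = f * w"
      using c(2) by simp
    then obtain h where h: "u = f * h"
      using weak[OF u(1)] w(1) by blast
    then have "f * ?c a = f * (?c b * h)"
      using u(2) by (simp only: mult_ac)
    then have "?c a = ?c b * h"
      using f(2) by simp
    \<comment> \<open>Compare constant coefficients.\<close>
    then have "a = b * ?l h 0"
      by (metis lookup_single_0_mult lookup_single_eq)
    then show "b dvd a" by simp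
  qed
  then have "v_op (to_fract ` (Idl\<^bsub>cring_class_ops\<^esub> A)) = range to_fract"
    unfolding v_op_eq_range_iff by blast
  moreover obtain t where "t \<in> ?K f"
    using f(2) by (metis in_keys_iff lookup_zero poly_mapping_eqI)
  then have "?l f t \<in> Idl\<^bsub>cring_class_ops\<^esub> A" "?l f t \<noteq> 0"
    using A by (auto simp: A_def in_keys_iff)
  then have "Idl\<^bsub>cring_class_ops\<^esub> A \<noteq> {0}" by blast
  moreover have "A \<subseteq> J" "finite A"
    using fg by (auto simp: A_def poly_extension_def)
  ultimately show ?thesis
    using that by blast
qed

section \<open>Comparison of the operations\<close>

lemma module_to_fract: "Modules.module (\<lambda>r x. to_fract r * x)"
  by unfold_locales (simp_all add: algebra_simps)

theorem theorem5:
  fixes I :: "'a::idom fract set"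
  assumes "I \<in> Fbar"
  shows "p_grade_op 0 I = e_op I \<and> p_grade_op 1 I = e_op I \<and> p_grade_op 2 I = w_op I"
proof (intro conjI)
  interpret K: Modules.module "\<lambda>(r :: 'a) x. to_fract r * x"
    by (rule module_to_fract)
  have I: "K.subspace I" "I \<noteq> {0}"
    using assms by (simp_all add: Fbar_def)
  have "x \<in> p_grade_op 1 I" for x
  proof -
    obtain y where y: "y \<in> I" "y \<noteq> 0"
      using I K.subspace_0 by blast
    obtain a b c d where x: "b \<noteq> 0" "x = to_fract a / to_fract b"
        and yd: "d \<noteq> 0" "y = to_fract c / to_fract d"
      using ex_to_fract_quotient by meson
    \<comment> \<open>The generator \<open>b * c\<close> is chosen so that \<open>b\<close> clears
      the denominator of \<open>x\<close>, while \<open>c\<close> is \<open>d\<close> times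
      \<open>y\<close> and so brings the product into \<open>I\<close>. It is nonzero because
      \<open>y\<close> is.\<close>
    have "x * to_fract (b * c * r) = to_fract (a * d * r) * y" for r
      using x yd by simp
    then have "x \<in> colon I (to_fract ` range ((*) (b * c)))"
      using K.subspace_scale[OF I(1) y(1)] by (auto simp: colon_def simp del: to_fract_mult)
    moreover have "enat 1 \<le> p_grade (range ((*) (b * c)))"
      using x yd y(2) by (intro p_grade_ge_1[of _ "b * c"] principal_mem_ideals) (auto intro: range_eqI[of _ _ 1])
    ultimately show ?thesis
      unfolding p_grade_op_def using principal_mem_ideals by blast
  qed
  then show 1: "p_grade_op 1 I = e_op I"
    by (auto simp: e_op_def)
  \<comment> \<open>A weaker grade bound admits more ideals into the union.\<close>
  have "p_grade_op 1 I \<subseteq> p_grade_op 0 I"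
    by (auto simp: p_grade_op_def zero_enat_def[symmetric])
  then show "p_grade_op 0 I = e_op I"
    using 1 by (auto simp: e_op_def)
  show "p_grade_op 2 I = w_op I"
  proof
    show "p_grade_op 2 I \<subseteq> w_op I"
    proof
      fix x assume "x \<in> p_grade_op 2 I"
      then obtain J where J: "J \<in> ideals" "enat 2 \<le> p_grade J" "x \<in> colon I (to_fract ` J)"
        by (auto simp: p_grade_op_def)
      obtain A where A: "finite A" "A \<subseteq> J" "Idl\<^bsub>cring_class_ops\<^esub> A \<noteq> {0}"
        "v_op (to_fract ` (Idl\<^bsub>cring_class_ops\<^esub> A)) = range to_fract"
        using p_grade_ge_2E[OF J(2)] .
      \<comment> \<open>Shrinking the ideal enlarges the colon, so \<open>J\<close> may be replaced
        by a finitely generated ideal inside it.\<close>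
      have "x \<in> colon I (to_fract ` (Idl\<^bsub>cring_class_ops\<^esub> A))"
        using J(3) genideal_subset[OF J(1) A(2)] by (auto simp: colon_def)
      then show "x \<in> w_op I"
        using A genideal_mem_ideals[of A] unfolding w_op_def by blast
    qed
    show "w_op I \<subseteq> p_grade_op 2 I"
      using p_grade_ge_2I unfolding w_op_def p_grade_op_def by blast
  qed
qed

end
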